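(* There exist absolute positive constants $C_1,C_2$ such that for all $\varepsilon\in(0,1)$, all integers $N\ge1$ and all primes $p>C_1/\varepsilon$, \[ \frac{1}{\#\mathcal V(p,N)^2}\#\Big\{(\beta_1,\beta_2)\in\mathcal V(p,N)^2:\ \Big|\mathfrak d_{p,N}(\beta_1,\beta_2)-\tfrac{1}{\sqrt2}\Big|\ge\varepsilon\Big\}\ \le\ \frac{C_2}{\varepsilon^2p}. \]
   Context: Let $p$ be an odd prime, $\omega=\exp(2\pi i/p)$, $\mathbb{Q}(\omega)$ with $\mathbb{Q}$-basis $\omega,\dots,\omega^{p-1}$. For $\gamma\in\mathbb{Q}(\omega)$, $\mathrm{Tr}(\gamma)=\sum_{\sigma\in\mathrm{Gal}(\mathbb{Q}(\omega)/\mathbb{Q})}\sigma(\gamma)$, $\psi(\gamma)=(\mathrm{Tr}(\gamma\omega),\dots,\mathrm{Tr}(\gamma\omega^{p-1}))$, $\|\gamma\|$ is the Euclidean norm of $\psi(\gamma)$, $d(\alpha,\beta)=\|\beta-\alpha\|$, and $\mathfrak d_{p,N}(\alpha,\beta)=d(\alpha,\beta)/(2Np(p-1)^{1/2})$. For an integer $N\ge1$, $\mathcal V(p,N)=\{\sum_{j=1}^{p-1}a_j\omega^j: a_j\in\{-N,N\}\}$. *)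

theory Defs
  imports "HOL-Analysis.L2_Norm" "HOL-Algebra.Generated_Fields" "HOL-Algebra.Algebraic_Closure_Type"
begin

abbreviation complex_ring :: "complex ring" where
  "complex_ring \<equiv> ring_of_type_algebra"

definition omega :: "nat \<Rightarrow> complex" where
  "omega p = exp (2 * of_real pi * \<i> / of_nat p)"

definition cyc_field :: "nat \<Rightarrow> complex set" where
  "cyc_field p = generate_field complex_ring {omega p}"

abbreviation cyc_ring :: "nat \<Rightarrow> complex ring" where
  "cyc_ring p \<equiv> complex_ring\<lparr>carrier := cyc_field p\<rparr>"

text \<open>Extensionality makes each automorphism of the field correspond to exactly one function
  on the complex numbers, so that summing over this set counts every automorphism once.\<close>

definition cyc_Gal :: "nat \<Rightarrow> (complex \<Rightarrow> complex) set" where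
  "cyc_Gal p = {\<sigma> \<in> extensional (cyc_field p).
     \<sigma> \<in> ring_iso (cyc_ring p) (cyc_ring p) \<and> (\<forall>q::rat. \<sigma> (of_rat q) = of_rat q)}"

definition cyc_Tr :: "nat \<Rightarrow> complex \<Rightarrow> complex" where
  "cyc_Tr p \<gamma> = (\<Sum>\<sigma>\<in>cyc_Gal p. \<sigma> \<gamma>)"

definition cyc_psi :: "nat \<Rightarrow> complex \<Rightarrow> nat \<Rightarrow> complex" where
  "cyc_psi p \<gamma> j = cyc_Tr p (\<gamma> * omega p ^ j)"

text \<open>Traces are rational numbers, here regarded as complex numbers; taking the modulus of each
  coordinate therefore gives the usual Euclidean norm of the vector of traces.\<close>

definition cyc_norm :: "nat \<Rightarrow> complex \<Rightarrow> real" where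
  "cyc_norm p \<gamma> = L2_set (\<lambda>j. cmod (cyc_psi p \<gamma> j)) {1..p - 1}"

definition cyc_dist :: "nat \<Rightarrow> complex \<Rightarrow> complex \<Rightarrow> real" where
  "cyc_dist p \<alpha> \<beta> = cyc_norm p (\<beta> - \<alpha>)"

definition cyc_ndist :: "nat \<Rightarrow> int \<Rightarrow> complex \<Rightarrow> complex \<Rightarrow> real" where
  "cyc_ndist p N \<alpha> \<beta> = cyc_dist p \<alpha> \<beta> / (2 * of_int N * real p * sqrt (real p - 1))"

definition cyc_V :: "nat \<Rightarrow> int \<Rightarrow> complex set" where
  "cyc_V p N = {(\<Sum>j = 1..p - 1. of_int (a j) * omega p ^ j) | a :: nat \<Rightarrow> int.
     \<forall>j\<in>{1..p - 1}. a j \<in> {- N, N}}"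

end

theory Submission
  imports Defs "HOL-Number_Theory.Cong"
begin

text \<open>Since the \<open>p\<close>-th cyclotomic polynomial is irreducible (Eisenstein), the Galois group consists of the
  \<open>p - 1\<close> maps \<open>\<omega> \<mapsto> \<omega>\<^sup>k\<close>, so \<open>Tr (\<omega>\<^sup>m)\<close> is \<open>p - 1\<close> or \<open>-1\<close> according to whether \<open>p\<close> divides \<open>m\<close>.
  Hence for \<open>\<gamma> = \<Sum>\<^sub>j c\<^sub>j \<omega>\<^sup>j\<close> one gets \<open>\<parallel>\<gamma>\<parallel>\<^sup>2 = p\<^sup>2 \<Sum> c\<^sub>j\<^sup>2 - (p + 1) (\<Sum> c\<^sub>j)\<^sup>2\<close>.  For two points with coefficients
  \<open>N s\<^sub>j\<close> and \<open>N t\<^sub>j\<close>, where \<open>s\<close> and \<open>t\<close> are sign vectors, and \<open>n = p - 1\<close>, the squared normalized distance is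
  \<open>1/2 - (\<Sum> s\<^sub>j t\<^sub>j) / (2 n) - (p + 1) (\<Sum> (t\<^sub>j - s\<^sub>j))\<^sup>2 / (4 p\<^sup>2 n)\<close>.  Its mean square deviation from
  \<open>1/2\<close> is at most \<open>5 / p\<close>, and Chebyshev's inequality gives the theorem.\<close>

section \<open>Irreducibility of the prime cyclotomic polynomial\<close>

text \<open>If \<open>B\<close> had positive degree, the indices up to the degree of
  \<open>A\<close> would all lie below the degree of \<open>A * B\<close>. Since \<open>q\<close>
  does not divide the constant coefficient of \<open>B\<close>, solving the convolution for its last
  term shows inductively that \<open>q\<close> divides every coefficient of \<open>A\<close>,
  against the assumption on the leading coefficient.\<close>

lemma eisenstein_factor:
  fixes A B :: "int poly"
  assumes q: "Factorial_Ring.prime q"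
    and low: "\<And>i. i < Polynomial.degree (A * B) \<Longrightarrow> q dvd Polynomial.coeff (A * B) i"
    and lead: "\<not> q dvd Polynomial.lead_coeff (A * B)"
    and const: "\<not> q dvd Polynomial.coeff B 0"
  shows "Polynomial.degree B = 0"
proof (rule ccontr)
  assume B: "Polynomial.degree B \<noteq> 0"
  have nz: "A * B \<noteq> 0" using lead by auto
  hence nz': "A \<noteq> 0" "B \<noteq> 0" by auto
  have deg: "Polynomial.degree A < Polynomial.degree (A * B)"
    using B nz' by (simp add: degree_mult_eq)
  have "q dvd Polynomial.coeff A i" if "i \<le> Polynomial.degree A" for i
    using that
  proof (induction i rule: less_induct)
    case (less i)
    have "q dvd Polynomial.coeff (A * B) i"
      using less deg by (intro low) auto
    also have "Polynomial.coeff (A * B) i =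
        (\<Sum>j<i. Polynomial.coeff A j * Polynomial.coeff B (i - j)) + Polynomial.coeff A i * Polynomial.coeff B 0"
      by (simp add: coeff_mult lessThan_Suc_atMost [symmetric])
    finally have "q dvd \<dots>" .
    moreover have "q dvd (\<Sum>j<i. Polynomial.coeff A j * Polynomial.coeff B (i - j))"
      using less by (intro dvd_sum) auto
    ultimately have "q dvd Polynomial.coeff A i * Polynomial.coeff B 0"
      by (simp add: dvd_add_right_iff)
    thus ?case using q const by (simp add: prime_dvd_mult_iff)
  qed
  hence "q dvd Polynomial.lead_coeff A" by simp
  thus False using lead by (simp add: lead_coeff_mult)
qed

text \<open>The factor \<open>c\<close> takes the place of Gauss's lemma: it is the common denominator of a rational
  factorization of \<open>P\<close>, and the prime \<open>q\<close> can be cancelled from it until Eisenstein's argument applies.\<close>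

lemma eisenstein_rational:
  fixes P A B :: "int poly"
  assumes q: "Factorial_Ring.prime q"
    and low: "\<And>i. i < Polynomial.degree P \<Longrightarrow> q dvd Polynomial.coeff P i"
    and lead: "\<not> q dvd Polynomial.lead_coeff P"
    and const: "\<not> q\<^sup>2 dvd Polynomial.coeff P 0"
    and AB: "A * B = Polynomial.smult c P" and c: "c \<noteq> 0"
  shows "Polynomial.degree A = 0 \<or> Polynomial.degree B = 0"
  using AB c
proof (induction "nat \<bar>c\<bar>" arbitrary: A B c rule: less_induct)
  case (less c)
  have prime_q: "prime_elem [:q:]"
    using prime_imp_prime_elem[OF q] by (simp only: prime_elem_const_poly_iff)
  have q2: "q \<ge> 2" using q prime_ge_2_int by blast
  show ?case
  proof (cases "q dvd c")
    case True
    then obtain d where d: "c = q * d" by (elim dvdE)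
    have "d \<noteq> 0" using less d by auto
    have "\<bar>d\<bar> < \<bar>c\<bar>" using d \<open>d \<noteq> 0\<close> q2 by (simp add: abs_mult)
    hence IH: "Polynomial.degree A' = 0 \<or> Polynomial.degree B' = 0"
      if "A' * B' = Polynomial.smult d P" for A' B'
      using less(1)[OF _ that \<open>d \<noteq> 0\<close>] by auto
    have eq: "A * B = [:q:] * Polynomial.smult d P" using less d by (simp add: mult.commute)
    hence "[:q:] dvd A * B" by (simp only: dvd_triv_left)
    \<comment> \<open>This is the content of Gauss's lemma: a prime integer stays prime as a
      constant polynomial, so it can be cancelled from one factor and from \<open>c\<close>.\<close>
    hence "[:q:] dvd A \<or> [:q:] dvd B" using prime_q by (simp add: prime_elem_dvd_mult_iff)
    thus ?thesis
    proof
      assume "[:q:] dvd A"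
      then obtain A' where A': "A = [:q:] * A'" by (elim dvdE)
      have "[:q:] * (A' * B) = [:q:] * Polynomial.smult d P" using eq A' by (simp only: mult.assoc)
      hence "A' * B = Polynomial.smult d P" using q2 by (subst (asm) mult_cancel_left) simp
      from IH[OF this] show ?thesis using A' q2 by simp
    next
      assume "[:q:] dvd B"
      then obtain B' where B': "B = [:q:] * B'" by (elim dvdE)
      have "[:q:] * (A * B') = [:q:] * Polynomial.smult d P" using eq B' by (simp only: mult.left_commute)
      hence "A * B' = Polynomial.smult d P" using q2 by (subst (asm) mult_cancel_left) simp
      from IH[OF this] show ?thesis using B' q2 by simp
    qed
  next
    case False
    have lowc: "q dvd Polynomial.coeff (A * B) i" if "i < Polynomial.degree (A * B)" for i
      using that less low[of i] by simp
    have leadc: "\<not> q dvd Polynomial.lead_coeff (A * B)"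
      using less lead False q by (simp add: prime_dvd_mult_iff)
    \<comment> \<open>With \<open>q\<close> and \<open>c\<close> coprime, at least one factor has
      constant coefficient prime to \<open>q\<close>; \<open>eisenstein_factor\<close> then applies
      to it, in either order of the factors.\<close>
    have "\<not> q dvd Polynomial.coeff A 0 \<or> \<not> q dvd Polynomial.coeff B 0"
    proof (rule ccontr)
      assume "\<not> ?thesis"
      hence "q * q dvd Polynomial.coeff A 0 * Polynomial.coeff B 0" by (intro mult_dvd_mono) auto
      also have "\<dots> = c * Polynomial.coeff P 0" using less
        by (metis coeff_mult_0 coeff_smult)
      finally have "q\<^sup>2 dvd c * Polynomial.coeff P 0" by (simp add: power2_eq_square)
      moreover have "coprime (q\<^sup>2) c" using False q by (simp add: prime_imp_coprime)
      ultimately show False using const by (simp add: coprime_dvd_mult_right_iff)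
    qed
    thus ?thesis
      using eisenstein_factor[OF q, of A B] eisenstein_factor[OF q, of B A] lowc leadc
      by (auto simp: mult.commute[of B A])
  qed
qed

lemma map_poly_of_int_mult:
  "map_poly of_int (f * g) = (map_poly of_int f * map_poly of_int g :: 'a::comm_ring_1 poly)"
  by (rule poly_eqI) (simp add: coeff_map_poly coeff_mult)

lemma clear_denominators:
  fixes f :: "rat poly"
  obtains d :: int and F :: "int poly" where "d \<noteq> 0" "Polynomial.smult (of_int d) f = map_poly of_int F"
proof -
  have "\<exists>d F. d \<noteq> 0 \<and> Polynomial.smult (of_int d) f = map_poly of_int F"
  proof (induction f)
    case 0
    show ?case by (rule exI[of _ 1], rule exI[of _ 0]) simp
  next
    case (pCons a f)
    then obtain d F where dF: "d \<noteq> 0" "Polynomial.smult (of_int d) f = map_poly of_int F" by blast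
    obtain u v where uv: "a = of_int u / of_int v" "v > 0"
      using Rat.Fract_of_int_quotient Rat_cases by metis
    have "Polynomial.smult (of_int (d * v)) (pCons a f) = map_poly of_int (pCons (d * u) (Polynomial.smult v F))"
      using uv dF(2)[symmetric] by (simp add: map_poly_pCons map_poly_smult mult.commute)
    thus ?case using dF uv by (intro exI[of _ "d * v"] exI conjI) auto
  qed
  thus ?thesis using that by blast
qed

text \<open>For prime \<open>p\<close> this is the \<open>p\<close>-th cyclotomic polynomial. The
  coefficient ring is left open because Eisenstein's argument runs over the integers and
  divisibility over the rationals.\<close>

definition prime_cyc :: "nat \<Rightarrow> 'a::comm_ring_1 poly" where
  "prime_cyc p = (\<Sum>i<p. Polynomial.monom 1 i)"

lemma prime_cyc_mult: "[:-1, 1:] * prime_cyc p = [:0, 1:] ^ p - (1 :: 'a::comm_ring_1 poly)"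
  using power_diff_1_eq[of "[:0,1:] :: 'a poly" p] by (simp add: prime_cyc_def one_pCons monom_altdef)

lemma pcompose_power: "(f ^ n) \<circ>\<^sub>p g = (f \<circ>\<^sub>p g) ^ n"
  for f g :: "'a::comm_ring_1 poly"
  by (induction n) (simp_all add: pcompose_mult pcompose_1)

text \<open>Substituting x + 1 for x in (x - 1) * \<open>prime_cyc p\<close> = x^p - 1 gives x times
  the shifted polynomial on the left and (x + 1)^p - 1 on the right. The resulting binomial
  coefficients are what makes the shift Eisenstein at \<open>p\<close>.\<close>

lemma coeff_prime_cyc_shift:
  "Polynomial.coeff (prime_cyc p \<circ>\<^sub>p [:1, 1:] :: 'a::idom poly) i = of_nat (p choose Suc i)"
proof -
  have "pCons 0 (prime_cyc p \<circ>\<^sub>p [:1, 1:]) = ([:-1, 1:] * prime_cyc p) \<circ>\<^sub>p [:1, 1 :: 'a:]"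
    by (subst pcompose_mult) (simp add: pcompose_pCons)
  also have "\<dots> = [:1, 1:] ^ p - 1"
    unfolding prime_cyc_mult by (simp add: pcompose_diff pcompose_power pcompose_pCons pcompose_1)
  finally have "Polynomial.coeff (pCons 0 (prime_cyc p \<circ>\<^sub>p [:1, 1 :: 'a:])) (Suc i) = Polynomial.coeff ([:1, 1:] ^ p - 1) (Suc i)"
    by simp
  hence eq: "Polynomial.coeff (prime_cyc p \<circ>\<^sub>p [:1, 1 :: 'a:]) i = Polynomial.coeff ([:1, 1:] ^ p) (Suc i)"
    by simp
  show ?thesis
  proof (cases "Suc i \<le> p")
    case True
    thus ?thesis by (simp add: eq coeff_linear_poly_power)
  next
    case False
    thus ?thesis unfolding eq by (simp add: coeff_eq_0 degree_linear_power binomial_eq_0)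
  qed
qed

lemma coeff_prime_cyc: "Polynomial.coeff (prime_cyc p) i = (if i < p then 1 else 0)"
  by (simp add: prime_cyc_def coeff_sum)

lemma degree_prime_cyc:
  assumes "p > 0"
  shows "Polynomial.degree (prime_cyc p :: 'a::comm_ring_1 poly) = p - 1"
  using assms by (intro antisym degree_le le_degree) (auto simp: coeff_prime_cyc)

lemma map_poly_prime_cyc:
  assumes "f 0 = 0" "f 1 = 1"
  shows "map_poly f (prime_cyc p) = prime_cyc p"
  using assms by (intro poly_eqI) (simp add: coeff_map_poly coeff_prime_cyc)

text \<open>Clearing denominators turns the factorization into an integer factorization of
  \<open>d * e\<close> times the polynomial. The shift by 1 preserves degrees and makes
  \<open>eisenstein_rational\<close> applicable.\<close>

lemma prime_cyc_factor:
  fixes f g :: "rat poly"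
  assumes p: "Factorial_Ring.prime p" and fg: "f * g = prime_cyc p"
  shows "Polynomial.degree f = 0 \<or> Polynomial.degree g = 0"
proof -
  obtain d F where F: "d \<noteq> 0" "Polynomial.smult (of_int d) f = map_poly of_int F"
    by (rule clear_denominators)
  obtain e G where G: "e \<noteq> 0" "Polynomial.smult (of_int e) g = map_poly of_int G"
    by (rule clear_denominators)
  let ?s = "[:1, 1:] :: int poly"
  let ?P = "prime_cyc p \<circ>\<^sub>p ?s"
  have p2: "p \<ge> 2" using p by (rule prime_ge_2_nat)
  have "map_poly of_int (F * G) = (Polynomial.smult (of_int (d * e)) (prime_cyc p) :: rat poly)"
    using fg by (simp add: map_poly_of_int_mult F(2)[symmetric] G(2)[symmetric] mult.commute)
  also have "\<dots> = map_poly of_int (Polynomial.smult (d * e) (prime_cyc p))"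
    by (simp add: map_poly_smult map_poly_prime_cyc)
  finally have "F * G = Polynomial.smult (d * e) (prime_cyc p)"
    by (simp add: poly_eq_iff coeff_map_poly flip: of_int_mult)
  hence "(F \<circ>\<^sub>p ?s) * (G \<circ>\<^sub>p ?s) = Polynomial.smult (d * e) ?P"
    by (metis pcompose_mult pcompose_smult)
  moreover have degP: "Polynomial.degree ?P = p - 1"
    using p2 by (simp add: degree_prime_cyc degree_pcompose)
  moreover have "int p dvd Polynomial.coeff ?P i" if "i < p - 1" for i
    unfolding coeff_prime_cyc_shift using that p by (simp add: dvd_choose_prime)
  moreover have "\<not> int p dvd Polynomial.coeff ?P (p - 1)"
    unfolding coeff_prime_cyc_shift using p2 by simp
  \<comment> \<open>The constant coefficient after the shift is \<open>p choose 1\<close>, that is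
    \<open>p\<close> itself.\<close>
  moreover have "\<not> (int p)\<^sup>2 dvd Polynomial.coeff ?P 0"
  proof
    assume "(int p)\<^sup>2 dvd Polynomial.coeff ?P 0"
    hence "p\<^sup>2 dvd p" unfolding coeff_prime_cyc_shift by (simp flip: of_nat_power)
    hence "p * p \<le> p * 1" using p2 by (intro dvd_imp_le) (auto simp: power2_eq_square)
    thus False using p2 by simp
  qed
  ultimately have "Polynomial.degree (F \<circ>\<^sub>p ?s) = 0 \<or> Polynomial.degree (G \<circ>\<^sub>p ?s) = 0"
    using F(1) G(1) p by (intro eisenstein_rational[of "int p" ?P _ _ "d * e"]) auto
  hence "Polynomial.degree F = 0 \<or> Polynomial.degree G = 0" by (simp add: degree_pcompose)
  moreover have "Polynomial.degree F = Polynomial.degree f"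
    using arg_cong[OF F(2), of Polynomial.degree] F(1) by (simp add: degree_map_poly)
  moreover have "Polynomial.degree G = Polynomial.degree g"
    using arg_cong[OF G(2), of Polynomial.degree] G(1) by (simp add: degree_map_poly)
  ultimately show ?thesis by simp
qed

section \<open>Evaluation of rational polynomials at complex numbers\<close>

definition rpoly_eval :: "rat poly \<Rightarrow> complex \<Rightarrow> complex" where
  "rpoly_eval f z = poly (map_poly of_rat f) z"

lemma rpoly_eval_pCons [simp]: "rpoly_eval (pCons a f) z = of_rat a + z * rpoly_eval f z"
  by (simp add: rpoly_eval_def map_poly_pCons)

lemma rpoly_eval_0 [simp]: "rpoly_eval 0 z = 0"
  by (simp add: rpoly_eval_def)

lemma rpoly_eval_1 [simp]: "rpoly_eval 1 z = 1"
  using rpoly_eval_pCons[of 1 0 z] by (simp add: one_pCons)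

lemma rpoly_eval_add [simp]: "rpoly_eval (f + g) z = rpoly_eval f z + rpoly_eval g z"
proof -
  have "map_poly of_rat (f + g) = (map_poly of_rat f + map_poly of_rat g :: complex poly)"
    by (rule poly_eqI) (simp add: coeff_map_poly of_rat_add)
  thus ?thesis by (simp add: rpoly_eval_def)
qed

lemma rpoly_eval_mult [simp]: "rpoly_eval (f * g) z = rpoly_eval f z * rpoly_eval g z"
proof -
  have "map_poly of_rat (f * g) = (map_poly of_rat f * map_poly of_rat g :: complex poly)"
    by (rule poly_eqI) (simp add: coeff_map_poly coeff_mult of_rat_sum of_rat_mult)
  thus ?thesis by (simp add: rpoly_eval_def)
qed

lemma rpoly_eval_power [simp]: "rpoly_eval (f ^ n) z = rpoly_eval f z ^ n"
  by (induction n) auto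

lemma rpoly_eval_uminus [simp]: "rpoly_eval (- f) z = - rpoly_eval f z"
  using rpoly_eval_mult[of "[:-1:]" f z] by (simp add: of_rat_minus)

lemma rpoly_eval_diff [simp]: "rpoly_eval (f - g) z = rpoly_eval f z - rpoly_eval g z"
  using rpoly_eval_add[of f "- g" z] by simp

lemma rpoly_eval_smult [simp]: "rpoly_eval (Polynomial.smult c f) z = of_rat c * rpoly_eval f z"
  using rpoly_eval_mult[of "[:c:]" f z] by simp

lemma rpoly_eval_prime_cyc: "rpoly_eval (prime_cyc p) z = (\<Sum>i<p. z ^ i)"
  by (simp add: rpoly_eval_def map_poly_prime_cyc) (simp add: prime_cyc_def poly_sum poly_monom)

lemma rpoly_eval_pcompose [simp]: "rpoly_eval (f \<circ>\<^sub>p g) z = rpoly_eval f (rpoly_eval g z)"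
  by (induction f) (auto simp: pcompose_pCons)

text \<open>By Bezout the gcd of the two polynomials also vanishes at \<open>z\<close>, so it is not
  a nonzero constant; irreducibility makes it a constant multiple of
  \<open>prime_cyc p\<close>.\<close>

lemma prime_cyc_dvd:
  assumes p: "Factorial_Ring.prime p" and z: "rpoly_eval (prime_cyc p) z = 0" and f: "rpoly_eval f z = 0"
  shows "prime_cyc p dvd f"
proof -
  define g where "g = gcd f (prime_cyc p)"
  have nz: "prime_cyc p \<noteq> (0 :: rat poly)"
    using p coeff_prime_cyc[of p 0, where ?'a = rat] by (auto simp: prime_gt_0_nat)
  have "rpoly_eval g z = 0"
    using f z unfolding g_def bezout_coefficients_fst_snd[symmetric] by simp
  obtain h where h: "prime_cyc p = g * h" unfolding g_def by (metis gcd_dvd2 dvdE)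
  from prime_cyc_factor[OF p h[symmetric]] show ?thesis
  proof
    assume "Polynomial.degree g = 0"
    then obtain c where "g = [:c:]" by (rule degree_eq_zeroE)
    with \<open>rpoly_eval g z = 0\<close> have "g = 0" by simp
    with h nz show ?thesis by simp
  next
    assume "Polynomial.degree h = 0"
    then obtain c where c: "h = [:c:]" by (rule degree_eq_zeroE)
    with nz h have "prime_cyc p = Polynomial.smult c g" "c \<noteq> 0" by auto
    moreover have "g dvd f" by (simp add: g_def)
    ultimately show ?thesis by (simp add: smult_dvd)
  qed
qed

section \<open>Galois group and trace\<close>

lemma complex_ring_simps [simp]:
  "carrier complex_ring = UNIV" "x \<otimes>\<^bsub>complex_ring\<^esub> y = x * y" "x \<oplus>\<^bsub>complex_ring\<^esub> y = x + y"
  "\<one>\<^bsub>complex_ring\<^esub> = 1" "\<zero>\<^bsub>complex_ring\<^esub> = 0"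
  by (simp_all add: ring_of_type_algebra_def)

lemma complex_ring_a_inv [simp]: "\<ominus>\<^bsub>complex_ring\<^esub> x = - x"
proof -
  interpret field complex_ring by (rule field_from_type_algebra)
  show ?thesis using minus_equality[of "- x" x] by simp
qed

lemma complex_ring_m_inv [simp]: "x \<noteq> 0 \<Longrightarrow> inv\<^bsub>complex_ring\<^esub> x = inverse x"
proof -
  assume "x \<noteq> 0"
  interpret field complex_ring by (rule field_from_type_algebra)
  show ?thesis using comm_inv_char[of x "inverse x"] \<open>x \<noteq> 0\<close> by simp
qed

section \<open>Powers of omega and the field they generate\<close>

context
  fixes p :: nat
  assumes p: "Factorial_Ring.prime p"
begin

lemma p_gt_1: "p > 1"
  using p by (rule prime_gt_1_nat)

lemma omega_power: "omega p ^ k = cis (2 * pi * real k / real p)"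
  by (simp add: omega_def cis_conv_exp exp_of_nat_mult [symmetric] field_simps)

lemma bij_betw_omega_power: "bij_betw (\<lambda>k. omega p ^ k) {..<p} {z. z ^ p = 1}"
  using bij_betw_roots_unity[of p] p_gt_1 by (simp add: omega_power)

lemma omega_power_p: "omega p ^ p = 1"
  using p_gt_1 by (simp add: omega_power)

lemma omega_power_mod: "omega p ^ k = omega p ^ (k mod p)"
proof -
  have "omega p ^ k = (omega p ^ p) ^ (k div p) * omega p ^ (k mod p)"
    by (simp flip: power_mult power_add)
  thus ?thesis by (simp add: omega_power_p)
qed

lemma omega_power_eq_1_iff: "omega p ^ k = 1 \<longleftrightarrow> p dvd k"
proof -
  have "omega p ^ k = 1 \<longleftrightarrow> omega p ^ (k mod p) = omega p ^ 0"
    by (subst omega_power_mod) simp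
  also have "\<dots> \<longleftrightarrow> k mod p = 0"
    using bij_betw_omega_power p_gt_1 by (subst inj_on_eq_iff[of _ "{..<p}"]) (auto simp: bij_betw_def)
  finally show ?thesis by (simp add: dvd_eq_mod_eq_0)
qed

lemma omega_power_root: "(omega p ^ k) ^ p = 1"
  by (metis omega_power_p power_mult mult.commute power_one)

lemma root_of_unity_cases:
  assumes "z ^ p = 1" "z \<noteq> 1"
  obtains k where "k \<in> {1..p - 1}" "z = omega p ^ k"
proof -
  from assms bij_betw_omega_power obtain k where k: "k < p" "z = omega p ^ k"
    unfolding bij_betw_def by blast
  with assms have "k \<noteq> 0" by (metis power_0)
  with k that[of k] show ?thesis by auto
qed

text \<open>Away from 1 this is the factorization of \<open>z ^ p - 1\<close>; at
  \<open>z = 1\<close> the value is \<open>p\<close>, which is nonzero.\<close>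

lemma rpoly_eval_prime_cyc_eq_0_iff:
  "rpoly_eval (prime_cyc p) z = 0 \<longleftrightarrow> z ^ p = 1 \<and> z \<noteq> 1"
  using power_diff_1_eq[of z p] p_gt_1 by (cases "z = 1") (auto simp: rpoly_eval_prime_cyc)

lemma omega_neq_1: "omega p \<noteq> 1"
  using omega_power_eq_1_iff[of 1] p_gt_1 by simp

lemma omega_power_neq_1: "k \<in> {1..p - 1} \<Longrightarrow> omega p ^ k \<noteq> 1"
  unfolding omega_power_eq_1_iff by (auto dest: dvd_imp_le)

text \<open>All nontrivial \<open>p\<close>-th roots of unity are zeros of the same irreducible
  polynomial, hence satisfy the same rational polynomial relations. This makes each map
  \<open>omega p\<close> to \<open>omega p ^ k\<close> both well defined and injective.\<close>

lemma conjugate_root: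
  assumes "z ^ p = 1" "z \<noteq> 1" "w ^ p = 1" "w \<noteq> 1" "rpoly_eval f z = 0"
  shows "rpoly_eval f w = 0"
proof -
  have "prime_cyc p dvd f"
    using assms by (intro prime_cyc_dvd[OF p, of z]) (auto simp: rpoly_eval_prime_cyc_eq_0_iff)
  moreover have "rpoly_eval (prime_cyc p) w = 0"
    using assms by (simp add: rpoly_eval_prime_cyc_eq_0_iff)
  ultimately show ?thesis by (elim dvdE) simp
qed

text \<open>The gcd of \<open>f\<close> and \<open>prime_cyc p\<close> is constant, as otherwise
  \<open>prime_cyc p\<close> would divide \<open>f\<close> and force the value to be 0. The Bezout
  cofactor of \<open>f\<close>, rescaled, then represents the inverse.\<close>

lemma rpoly_eval_omega_inverse:
  assumes "rpoly_eval f (omega p) \<noteq> 0"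
  obtains g where "inverse (rpoly_eval f (omega p)) = rpoly_eval g (omega p)"
proof -
  have root: "rpoly_eval (prime_cyc p) (omega p) = 0"
    by (simp add: rpoly_eval_prime_cyc_eq_0_iff omega_power_p omega_neq_1)
  obtain h where h: "prime_cyc p = gcd f (prime_cyc p) * h" by (metis gcd_dvd2 dvdE)
  have nz: "prime_cyc p \<noteq> (0 :: rat poly)"
    using p coeff_prime_cyc[of p 0, where ?'a = rat] by (auto simp: prime_gt_0_nat)
  have "Polynomial.degree (gcd f (prime_cyc p)) = 0"
    using prime_cyc_factor[OF p h[symmetric]]
  proof
    assume "Polynomial.degree h = 0"
    then obtain c where c: "h = [:c:]" by (rule degree_eq_zeroE)
    with nz h have "prime_cyc p = Polynomial.smult c (gcd f (prime_cyc p))" "c \<noteq> 0" by auto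
    hence "prime_cyc p dvd f" by (metis gcd_dvd1 smult_dvd)
    with root assms show ?thesis by (elim dvdE) simp
  qed
  then obtain c where c: "gcd f (prime_cyc p) = [:c:]" by (rule degree_eq_zeroE)
  with nz h have "c \<noteq> 0" by auto
  define b where "b = fst (bezout_coefficients f (prime_cyc p))"
  have "rpoly_eval b (omega p) * rpoly_eval f (omega p) = of_rat c"
    using arg_cong[OF bezout_coefficients_fst_snd[of f "prime_cyc p"], of "\<lambda>f. rpoly_eval f (omega p)"]
    by (simp add: root c b_def)
  hence "rpoly_eval f (omega p) * rpoly_eval (Polynomial.smult (inverse c) b) (omega p) = 1"
    using \<open>c \<noteq> 0\<close> by (simp add: of_rat_inverse mult.left_commute mult.commute)
  hence "inverse (rpoly_eval f (omega p)) = rpoly_eval (Polynomial.smult (inverse c) b) (omega p)"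
    by (rule inverse_unique)
  thus ?thesis by (rule that)
qed

text \<open>The polynomial values in \<open>omega p\<close> already form a field, inverses being the
  only closure property that uses irreducibility. Conversely the generated field contains the
  rationals and \<open>omega p\<close>.\<close>

lemma cyc_field_eq: "cyc_field p = range (\<lambda>f. rpoly_eval f (omega p))"
proof
  show "cyc_field p \<subseteq> range (\<lambda>f. rpoly_eval f (omega p))"
  proof
    fix x assume "x \<in> cyc_field p"
    thus "x \<in> range (\<lambda>f. rpoly_eval f (omega p))"
      unfolding cyc_field_def
    proof induction
      case one
      show ?case by (rule range_eqI[of _ _ 1]) simp
    next
      case (incl h)
      thus ?case by (intro range_eqI[of _ _ "[:0, 1:]"]) simp
    next
      case (a_inv h)
      then obtain f where "h = rpoly_eval f (omega p)" by blast
      thus ?case by (intro range_eqI[of _ _ "- f"]) simp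
    next
      case (m_inv h)
      then obtain f where f: "h = rpoly_eval f (omega p)" by blast
      with m_inv have "rpoly_eval f (omega p) \<noteq> 0" by simp
      then obtain g where "inverse h = rpoly_eval g (omega p)"
        unfolding f by (rule rpoly_eval_omega_inverse)
      thus ?case using m_inv by (intro range_eqI[of _ _ g]) simp
    next
      case (eng_add h1 h2)
      then obtain f g where "h1 = rpoly_eval f (omega p)" "h2 = rpoly_eval g (omega p)" by blast
      thus ?case by (intro range_eqI[of _ _ "f + g"]) simp
    next
      case (eng_mult h1 h2)
      then obtain f g where "h1 = rpoly_eval f (omega p)" "h2 = rpoly_eval g (omega p)" by blast
      thus ?case by (intro range_eqI[of _ _ "f * g"]) simp
    qed
  qed
next
  have add: "x + y \<in> cyc_field p" and mult: "x * y \<in> cyc_field p" if "x \<in> cyc_field p" "y \<in> cyc_field p" for x y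
    using generate_field.eng_add[of x complex_ring "{omega p}" y] generate_field.eng_mult[of x complex_ring "{omega p}" y] that
    by (simp_all add: cyc_field_def)
  have one: "1 \<in> cyc_field p"
    using generate_field.one[of complex_ring "{omega p}"] by (simp add: cyc_field_def)
  have uminus: "- x \<in> cyc_field p" if "x \<in> cyc_field p" for x
    using generate_field.a_inv[of x complex_ring "{omega p}"] that by (simp add: cyc_field_def)
  \<comment> \<open>For \<open>x = 0\<close> the claim follows from the convention
    \<open>inverse 0 = 0\<close>.\<close>
  have inv: "inverse x \<in> cyc_field p" if "x \<in> cyc_field p" for x
    using generate_field.m_inv[of x complex_ring "{omega p}"] that
    by (cases "x = 0") (simp_all add: cyc_field_def)
  have omega: "omega p \<in> cyc_field p"
    using generate_field.incl[of "omega p" "{omega p}" complex_ring] by (simp add: cyc_field_def)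
  have zero: "0 \<in> cyc_field p" using add[OF one uminus[OF one]] by simp
  have nat: "of_nat n \<in> cyc_field p" for n by (induction n) (simp_all add: add one zero)
  have int: "of_int n \<in> cyc_field p" for n
    by (cases n rule: int_cases2) (simp_all add: nat uminus)
  have rat: "of_rat r \<in> cyc_field p" for r
  proof -
    obtain a b where "r = of_int a / of_int b"
      by (cases r) (simp add: Fract_of_int_quotient)
    hence "of_rat r = (of_int a * inverse (of_int b) :: complex)"
      by (simp add: of_rat_divide divide_inverse[symmetric])
    thus ?thesis by (simp add: int mult inv)
  qed
  have "rpoly_eval f (omega p) \<in> cyc_field p" for f
    by (induction f) (simp_all add: add mult rat omega zero)
  thus "range (\<lambda>f. rpoly_eval f (omega p)) \<subseteq> cyc_field p" by blast
qed

text \<open>An arbitrary polynomial representing \<open>z\<close> is re-evaluated at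
  \<open>omega p ^ k\<close>; \<open>cyc_conj_eval\<close> shows that the choice does not matter for
  \<open>k\<close> in \<open>{1..p - 1}\<close>. The restriction matches the extensionality required
  in \<open>cyc_Gal\<close>.\<close>

definition cyc_conj :: "nat \<Rightarrow> complex \<Rightarrow> complex" where
  "cyc_conj k = restrict (\<lambda>z. rpoly_eval (SOME f. rpoly_eval f (omega p) = z) (omega p ^ k)) (cyc_field p)"

text \<open>Two polynomials with the same value at \<open>omega p\<close> differ by one vanishing
  there, and by \<open>conjugate_root\<close> the difference vanishes at \<open>omega p ^ k\<close>
  too.\<close>

lemma cyc_conj_eval:
  assumes "k \<in> {1..p - 1}"
  shows "cyc_conj k (rpoly_eval f (omega p)) = rpoly_eval f (omega p ^ k)"
proof -
  define g where "g = (SOME g. rpoly_eval g (omega p) = rpoly_eval f (omega p))"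
  have "rpoly_eval g (omega p) = rpoly_eval f (omega p)" unfolding g_def by (rule someI) (rule refl)
  hence "rpoly_eval (g + - f) (omega p) = 0" by simp
  hence "rpoly_eval (g + - f) (omega p ^ k) = 0"
    by (rule conjugate_root[of "omega p", rotated -1])
      (use assms in \<open>simp_all add: omega_power_p omega_neq_1 omega_power_root omega_power_neq_1\<close>)
  thus ?thesis by (simp add: cyc_conj_def cyc_field_eq g_def)
qed

lemma cyc_conj_in_Gal:
  assumes k: "k \<in> {1..p - 1}"
  shows "cyc_conj k \<in> cyc_Gal p"
proof -
  have root: "omega p ^ k \<noteq> 1" using k by (rule omega_power_neq_1)
  \<comment> \<open>Here \<open>m\<close> inverts \<open>k\<close> modulo \<open>p\<close>;
    substituting x^m into a polynomial later yields preimages under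
    \<open>cyc_conj k\<close>.\<close>
  obtain m where m: "omega p ^ (m * k) = omega p"
  proof -
    have "\<not> p dvd k" using k p_gt_1 by (auto dest: dvd_imp_le)
    hence "coprime k p" using p by (simp add: prime_imp_coprime coprime_commute[of k])
    then obtain m where "[k * m = 1] (mod p)" using cong_solve_coprime_nat[of k p] by auto
    hence "(m * k) mod p = 1 mod p" by (simp add: cong_def mult.commute)
    hence "omega p ^ (m * k) = omega p ^ 1" by (metis omega_power_mod)
    thus ?thesis using that by simp
  qed
  have m': "(omega p ^ k) ^ m = omega p" using m by (metis mult.commute power_mult)
  have hom: "cyc_conj k \<in> ring_hom (cyc_ring p) (cyc_ring p)"
  proof (rule ring_hom_memI)
    fix x assume "x \<in> carrier (cyc_ring p)"
    then obtain f where f: "x = rpoly_eval f (omega p)" by (auto simp: cyc_field_eq)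
    have "cyc_conj k x = rpoly_eval (f \<circ>\<^sub>p [:0, 1:] ^ k) (omega p)"
      using k by (simp add: f cyc_conj_eval)
    hence "cyc_conj k x \<in> cyc_field p" unfolding cyc_field_eq by (rule range_eqI)
    thus "cyc_conj k x \<in> carrier (cyc_ring p)" by simp
    fix y assume "y \<in> carrier (cyc_ring p)"
    then obtain g where g: "y = rpoly_eval g (omega p)" by (auto simp: cyc_field_eq)
    show "cyc_conj k (x \<otimes>\<^bsub>cyc_ring p\<^esub> y) = cyc_conj k x \<otimes>\<^bsub>cyc_ring p\<^esub> cyc_conj k y"
      using cyc_conj_eval[OF k, of "f * g"] cyc_conj_eval[OF k] by (simp add: f g)
    show "cyc_conj k (x \<oplus>\<^bsub>cyc_ring p\<^esub> y) = cyc_conj k x \<oplus>\<^bsub>cyc_ring p\<^esub> cyc_conj k y"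
      using cyc_conj_eval[OF k, of "f + g"] cyc_conj_eval[OF k] by (simp add: f g)
  next
    show "cyc_conj k \<one>\<^bsub>cyc_ring p\<^esub> = \<one>\<^bsub>cyc_ring p\<^esub>"
      using cyc_conj_eval[OF k, of 1] by simp
  qed
  have "inj_on (cyc_conj k) (cyc_field p)"
  proof (rule inj_onI)
    fix x y assume "x \<in> cyc_field p" "y \<in> cyc_field p" and eq: "cyc_conj k x = cyc_conj k y"
    then obtain f g where fg: "x = rpoly_eval f (omega p)" "y = rpoly_eval g (omega p)"
      by (auto simp: cyc_field_eq)
    have "rpoly_eval (f - g) (omega p ^ k) = 0" using eq k by (simp add: fg cyc_conj_eval)
    hence "rpoly_eval (f - g) (omega p) = 0"
      by (rule conjugate_root[of "omega p ^ k", rotated -1])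
        (simp_all add: root omega_power_p omega_neq_1 omega_power_root)
    thus "x = y" by (simp add: fg)
  qed
  moreover have "cyc_field p \<subseteq> cyc_conj k ` cyc_field p"
  proof
    fix x assume "x \<in> cyc_field p"
    then obtain f where f: "x = rpoly_eval f (omega p)" by (auto simp: cyc_field_eq)
    have "cyc_conj k (rpoly_eval (f \<circ>\<^sub>p [:0, 1:] ^ m) (omega p)) = x"
      using k m' by (subst cyc_conj_eval) (simp_all add: f)
    thus "x \<in> cyc_conj k ` cyc_field p" by (metis cyc_field_eq imageI rangeI)
  qed
  moreover have "cyc_conj k ` cyc_field p \<subseteq> cyc_field p"
    using ring_hom_memE(1)[OF hom] by auto
  moreover have "cyc_conj k (of_rat q) = of_rat q" for q
    using cyc_conj_eval[OF k, of "[:q:]"] by simp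
  ultimately show ?thesis
    using hom by (auto simp: cyc_Gal_def ring_iso_def bij_betw_def cyc_conj_def)
qed

text \<open>An automorphism fixing the rationals commutes with \<open>rpoly_eval\<close>, so it is
  determined by the image of \<open>omega p\<close>. That image is again a zero of
  \<open>prime_cyc p\<close>, hence one of the nontrivial powers.\<close>

lemma cyc_Gal_eq: "cyc_Gal p = cyc_conj ` {1..p - 1}"
proof
  show "cyc_conj ` {1..p - 1} \<subseteq> cyc_Gal p" using cyc_conj_in_Gal by blast
  show "cyc_Gal p \<subseteq> cyc_conj ` {1..p - 1}"
  proof
    fix \<sigma> assume \<sigma>: "\<sigma> \<in> cyc_Gal p"
    hence hom: "\<sigma> \<in> ring_hom (cyc_ring p) (cyc_ring p)" and inj: "inj_on \<sigma> (cyc_field p)"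
      and rat: "\<And>q. \<sigma> (of_rat q) = of_rat q" and ext: "\<sigma> \<in> extensional (cyc_field p)"
      by (auto simp: cyc_Gal_def ring_iso_def bij_betw_def)
    have mem: "rpoly_eval f (omega p) \<in> cyc_field p" for f by (simp add: cyc_field_eq)
    have omega_mem: "omega p \<in> cyc_field p" and one_mem: "1 \<in> cyc_field p"
      using mem[of "[:0, 1:]"] mem[of 1] by simp_all
    have rat_mem: "of_rat q \<in> cyc_field p" for q using mem[of "[:q:]"] by simp
    have add: "\<sigma> (x + y) = \<sigma> x + \<sigma> y" and mult: "\<sigma> (x * y) = \<sigma> x * \<sigma> y"
      if "x \<in> cyc_field p" "y \<in> cyc_field p" for x y
      using ring_hom_memE(2,3)[OF hom, of x y] that by simp_all
    have eval: "\<sigma> (rpoly_eval f (omega p)) = rpoly_eval f (\<sigma> (omega p))" for f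
    proof (induction f)
      case 0
      show ?case using rat[of 0] by simp
    next
      case (pCons a f)
      have "omega p * rpoly_eval f (omega p) \<in> cyc_field p" using mem[of "[:0, 1:] * f"] by simp
      thus ?case using pCons by (simp add: add mult rat rat_mem mem omega_mem)
    qed
    have "rpoly_eval (prime_cyc p) (\<sigma> (omega p)) = \<sigma> (rpoly_eval (prime_cyc p) (omega p))"
      by (rule eval[symmetric])
    also have "rpoly_eval (prime_cyc p) (omega p) = 0"
      by (simp add: rpoly_eval_prime_cyc_eq_0_iff omega_power_p omega_neq_1)
    finally have "rpoly_eval (prime_cyc p) (\<sigma> (omega p)) = 0" using rat[of 0] by simp
    then obtain k where k: "k \<in> {1..p - 1}" "\<sigma> (omega p) = omega p ^ k"
      by (auto simp: rpoly_eval_prime_cyc_eq_0_iff elim: root_of_unity_cases)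
    have "\<sigma> = cyc_conj k"
    proof (rule extensionalityI[OF ext])
      show "cyc_conj k \<in> extensional (cyc_field p)" by (simp add: cyc_conj_def)
    next
      fix x assume "x \<in> cyc_field p"
      then obtain f where f: "x = rpoly_eval f (omega p)" by (auto simp: cyc_field_eq)
      show "\<sigma> x = cyc_conj k x" using k by (simp add: f eval cyc_conj_eval)
    qed
    with k show "\<sigma> \<in> cyc_conj ` {1..p - 1}" by blast
  qed
qed

text \<open>Distinct exponents send \<open>omega p\<close> to distinct values, so the sum over the
  Galois group can be reindexed by exponents.\<close>

lemma cyc_Tr_eval: "cyc_Tr p (rpoly_eval f (omega p)) = (\<Sum>k = 1..p - 1. rpoly_eval f (omega p ^ k))"
proof -
  have "inj_on cyc_conj {1..p - 1}"
  proof (rule inj_onI)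
    fix k l assume kl: "k \<in> {1..p - 1}" "l \<in> {1..p - 1}" "cyc_conj k = cyc_conj l"
    hence "omega p ^ k = omega p ^ l"
      using cyc_conj_eval[of k "[:0, 1:]"] cyc_conj_eval[of l "[:0, 1:]"] by simp
    moreover have "k \<in> {..<p}" "l \<in> {..<p}" using kl p_gt_1 by auto
    ultimately show "k = l" using bij_betw_omega_power unfolding bij_betw_def inj_on_def by blast
  qed
  thus ?thesis unfolding cyc_Tr_def cyc_Gal_eq
    by (subst sum.reindex) (auto intro!: sum.cong simp: cyc_conj_eval)
qed

end

section \<open>Trace vectors and norms of integer combinations of powers of omega\<close>

definition cyc_sum :: "nat \<Rightarrow> (nat \<Rightarrow> int) \<Rightarrow> complex" where
  "cyc_sum p c = (\<Sum>j = 1..p - 1. of_int (c j) * omega p ^ j)"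

lemma cyc_sum_diff: "cyc_sum p c - cyc_sum p d = cyc_sum p (\<lambda>j. c j - d j)"
  by (simp add: cyc_sum_def sum_subtractf left_diff_distrib)

lemma rpoly_eval_sum: "rpoly_eval (\<Sum>i\<in>I. f i) z = (\<Sum>i\<in>I. rpoly_eval (f i) z)"
  by (induction I rule: infinite_finite_induct) auto

context
  fixes p :: nat
  assumes p: "Factorial_Ring.prime p"
begin

text \<open>This is the trace of \<open>omega p ^ m\<close>: exchanging exponents gives a full
  geometric sum of ratio \<open>omega p ^ m\<close>, less its term for exponent 0.\<close>

lemma sum_conjugates_omega_power:
  "(\<Sum>k = 1..p - 1. (omega p ^ k) ^ m) = (if p dvd m then of_nat p else 0) - 1"
proof -
  have "(\<Sum>k = 1..p - 1. (omega p ^ k) ^ m) = (\<Sum>k = 1..p - 1. (omega p ^ m) ^ k)"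
    by (simp add: mult.commute flip: power_mult)
  also have "\<dots> = (\<Sum>k<p. (omega p ^ m) ^ k) - 1"
  proof -
    have "{..<p} = insert 0 {1..p - 1}" using p_gt_1[OF p] by auto
    thus ?thesis by simp
  qed
  also have "(\<Sum>k<p. (omega p ^ m) ^ k) = (if p dvd m then of_nat p else 0)"
    using power_diff_1_eq[of "omega p ^ m" p] omega_power_root[OF p, of m] omega_power_eq_1_iff[OF p, of m]
    by (cases "p dvd m") auto
  finally show ?thesis .
qed

text \<open>Expanding the trace linearly, every term contributes \<open>- c j\<close>. Since 0 <
  \<open>j + i\<close> < 2p, only \<open>j = p - i\<close> makes \<open>p\<close> divide
  \<open>j + i\<close>, and that term contributes a further \<open>p * c (p - i)\<close>.\<close>

lemma cyc_psi_cyc_sum: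
  assumes i: "i \<in> {1..p - 1}"
  shows "cyc_psi p (cyc_sum p c) i = of_int (int p * c (p - i) - (\<Sum>j = 1..p - 1. c j))"
proof -
  \<comment> \<open>\<open>f\<close> represents the product of \<open>cyc_sum p c\<close> with
    \<open>omega p ^ i\<close>, so that its trace can be computed by
    \<open>cyc_Tr_eval\<close>.\<close>
  define f :: "rat poly" where "f = (\<Sum>j = 1..p - 1. Polynomial.smult (of_int (c j)) ([:0, 1:] ^ (j + i)))"
  have f: "rpoly_eval f z = (\<Sum>j = 1..p - 1. of_int (c j) * z ^ (j + i))" for z
    unfolding f_def rpoly_eval_sum by simp
  have "cyc_psi p (cyc_sum p c) i = cyc_Tr p (rpoly_eval f (omega p))"
    unfolding f cyc_psi_def cyc_sum_def by (simp add: sum_distrib_right power_add mult.assoc)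
  also have "\<dots> = (\<Sum>k = 1..p - 1. \<Sum>j = 1..p - 1. of_int (c j) * (omega p ^ k) ^ (j + i))"
    using cyc_Tr_eval[OF p, of f] by (simp only: f)
  also have "\<dots> = (\<Sum>j = 1..p - 1. of_int (c j) * (\<Sum>k = 1..p - 1. (omega p ^ k) ^ (j + i)))"
    by (subst sum.swap) (simp only: sum_distrib_left)
  also have "\<dots> = (\<Sum>j = 1..p - 1. (if j = p - i then of_nat p * of_int (c j) else 0) - of_int (c j))"
  proof (rule sum.cong[OF refl])
    fix j assume j: "j \<in> {1..p - 1}"
    have "p dvd j + i \<longleftrightarrow> j = p - i"
    proof
      assume "p dvd j + i"
      then obtain m where m: "j + i = p * m" by (elim dvdE)
      have "m = 1"
      proof (rule ccontr)
        assume "m \<noteq> 1"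
        then consider "m = 0" | "m \<ge> 2" by linarith
        thus False
        proof cases
          case 2
          hence "p * 2 \<le> p * m" by simp
          moreover have "j + i < p * 2" using i j p_gt_1[OF p] unfolding atLeastAtMost_iff by linarith
          ultimately show False using m by linarith
        qed (use m j in auto)
      qed
      thus "j = p - i" using m by simp
    qed (use i in auto)
    thus "of_int (c j) * (\<Sum>k = 1..p - 1. (omega p ^ k) ^ (j + i)) =
        (if j = p - i then of_nat p * of_int (c j) else 0) - of_int (c j)"
      unfolding sum_conjugates_omega_power by (simp add: algebra_simps)
  qed
  also have "\<dots> = of_int (int p * c (p - i) - (\<Sum>j = 1..p - 1. c j))"
  proof -
    have "p - i \<in> {1..p - 1}" using i p_gt_1[OF p] by auto
    thus ?thesis by (simp add: sum_subtractf)
  qed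
  finally show ?thesis .
qed

lemma bij_betw_complement: "bij_betw (\<lambda>i. p - i) {1..p - 1} {1..p - 1}"
  by (rule bij_betwI[where g = "\<lambda>i. p - i"]) auto

text \<open>Linear independence is read off the traces: if all coordinates of \<open>cyc_psi\<close>
  vanish, every \<open>p * c j\<close> equals the coefficient sum \<open>S\<close>. Adding these
  equations gives p S = (p - 1) S, so \<open>S\<close> and all coefficients are 0.\<close>

lemma cyc_sum_eq_0:
  assumes "cyc_sum p c = 0" "j \<in> {1..p - 1}"
  shows "c j = 0"
proof -
  define S where "S = (\<Sum>j = 1..p - 1. c j)"
  have "cyc_psi p 0 i = 0" for i
    using cyc_Tr_eval[OF p, of 0] by (simp add: cyc_psi_def)
  hence "of_int (int p * c (p - i) - S) = (0 :: complex)" if "i \<in> {1..p - 1}" for i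
    using cyc_psi_cyc_sum[OF that, of c] assms(1) by (simp add: S_def)
  hence *: "int p * c (p - i) = S" if "i \<in> {1..p - 1}" for i
    using that by (metis of_int_eq_0_iff right_minus_eq)
  have c: "int p * c j = S" if "j \<in> {1..p - 1}" for j
  proof -
    have "p - j \<in> {1..p - 1}" "p - (p - j) = j" using that p_gt_1[OF p] by auto
    thus ?thesis using *[of "p - j"] by simp
  qed
  have "int p * S = (\<Sum>j = 1..p - 1. int p * c j)" by (simp add: S_def sum_distrib_left)
  also have "\<dots> = (\<Sum>j = 1..p - 1. S)" using c by (intro sum.cong) auto
  finally have "int p * S = int (p - 1) * S" by simp
  hence "S = 0" using p_gt_1[OF p] by (simp add: of_nat_diff left_diff_distrib)
  thus ?thesis using c[OF assms(2)] p_gt_1[OF p] by simp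
qed

text \<open>After reversing the index, the coordinates are p c_i - S. Squaring and summing produces
  -2 p S^2 from the cross terms and (p - 1) S^2 from the constant terms, together -(p + 1)
  S^2.\<close>

lemma cyc_norm_cyc_sum:
  "(cyc_norm p (cyc_sum p c))\<^sup>2 =
     (real p)\<^sup>2 * (\<Sum>j = 1..p - 1. (real_of_int (c j))\<^sup>2) - (real p + 1) * (\<Sum>j = 1..p - 1. real_of_int (c j))\<^sup>2"
proof -
  define S where "S = (\<Sum>j = 1..p - 1. real_of_int (c j))"
  have "(cyc_norm p (cyc_sum p c))\<^sup>2 = (\<Sum>i = 1..p - 1. (cmod (cyc_psi p (cyc_sum p c) i))\<^sup>2)"
    by (simp add: cyc_norm_def L2_set_def sum_nonneg)
  also have "\<dots> = (\<Sum>i = 1..p - 1. (real p * c (p - i) - S)\<^sup>2)"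
    by (rule sum.cong[OF refl]) (simp only: cyc_psi_cyc_sum norm_of_int, simp add: S_def)
  also have "\<dots> = (\<Sum>i = 1..p - 1. (real p * c i - S)\<^sup>2)"
    by (rule sum.reindex_bij_betw[OF bij_betw_complement])
  also have "\<dots> = (\<Sum>i = 1..p - 1. (real p)\<^sup>2 * (real_of_int (c i))\<^sup>2 - 2 * real p * S * c i + S\<^sup>2)"
    by (simp add: power2_eq_square algebra_simps)
  also have "\<dots> = (real p)\<^sup>2 * (\<Sum>i = 1..p - 1. (real_of_int (c i))\<^sup>2) - 2 * real p * S * S + real (p - 1) * S\<^sup>2"
    by (simp add: sum.distrib sum_subtractf S_def flip: sum_distrib_left)
  also have "\<dots> = (real p)\<^sup>2 * (\<Sum>i = 1..p - 1. (real_of_int (c i))\<^sup>2) - (real p + 1) * S\<^sup>2"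
    using p_gt_1[OF p] by (simp add: of_nat_diff power2_eq_square algebra_simps)
  finally show ?thesis by (simp add: S_def)
qed

end

section \<open>Second moments of random signs\<close>

text \<open>The extensional product makes a sign vector determined by its values on
  \<open>J\<close>, so there are exactly \<open>2 ^ card J\<close> of them.\<close>

abbreviation signs :: "'a set \<Rightarrow> ('a \<Rightarrow> int) set" where
  "signs J \<equiv> PiE J (\<lambda>_. {-1, 1})"

lemma sum_signs_insert:
  fixes F :: "('a \<Rightarrow> int) \<Rightarrow> real"
  assumes "finite J" "x \<notin> J"
  shows "(\<Sum>s\<in>signs (insert x J). F s) = (\<Sum>s\<in>signs J. F (s(x := -1)) + F (s(x := 1)))"
proof -
  have "(\<Sum>s\<in>signs (insert x J). F s) = (\<Sum>(u, s)\<in>{-1, 1} \<times> signs J. F (s(x := u)))"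
    unfolding PiE_insert_eq using assms inj_combinator[of x J "\<lambda>_. {-1, 1 :: int}"]
    by (subst sum.reindex) (auto simp: case_prod_unfold)
  thus ?thesis by (simp add: sum.distrib sum.cartesian_product[symmetric])
qed

text \<open>Pairing the two signs of the new index cancels the cross term, as (y + a)^2 + (y - a)^2
  = 2 y^2 + 2 a^2. In probabilistic terms, independent signs are uncorrelated.\<close>

lemma sum_signs_square:
  fixes a :: "'a \<Rightarrow> real"
  assumes "finite J"
  shows "(\<Sum>s\<in>signs J. (\<Sum>j\<in>J. a j * s j)\<^sup>2) = 2 ^ card J * (\<Sum>j\<in>J. (a j)\<^sup>2)"
  using assms
proof (induction J rule: finite_induct)
  case empty
  show ?case by simp
next
  case (insert x J)
  have upd: "(\<Sum>j\<in>insert x J. a j * real_of_int ((s(x := u)) j)) = a x * u + (\<Sum>j\<in>J. a j * s j)" for s u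
    using insert by (auto intro!: sum.cong)
  have card: "card (signs J) = 2 ^ card J"
    using insert by (simp add: card_PiE numeral_2_eq_2)
  have "(\<Sum>s\<in>signs (insert x J). (\<Sum>j\<in>insert x J. a j * s j)\<^sup>2) =
      (\<Sum>s\<in>signs J. 2 * (a x)\<^sup>2 + 2 * (\<Sum>j\<in>J. a j * s j)\<^sup>2)"
    by (subst sum_signs_insert[OF insert(1,2)], simp only: upd) (simp add: power2_eq_square algebra_simps)
  also have "\<dots> = 2 ^ card J * (2 * (a x)\<^sup>2) + 2 * (\<Sum>s\<in>signs J. (\<Sum>j\<in>J. a j * s j)\<^sup>2)"
    by (simp add: sum.distrib card sum_distrib_left)
  also have "\<dots> = 2 ^ card (insert x J) * (\<Sum>j\<in>insert x J. (a j)\<^sup>2)"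
    using insert by (simp add: algebra_simps)
  finally show ?case .
qed

text \<open>The crude bound on \<open>W\<close> replaces one factor \<open>W\<^sup>2\<close> of the fourth power, so that no fourth moment
  of the random signs is ever needed.\<close>

lemma le_second_moment_term:
  fixes n q U W :: real
  assumes n: "n > 0" and W: "W\<^sup>2 \<le> 4 * n\<^sup>2"
  shows "(U / (2 * n) + q * W\<^sup>2 / (4 * n))\<^sup>2 \<le> U\<^sup>2 / (2 * n\<^sup>2) + q\<^sup>2 * W\<^sup>2 / 2"
proof -
  define x where "x = U / (2 * n)"
  define y where "y = q * W\<^sup>2 / (4 * n)"
  have "(x + y)\<^sup>2 \<le> 2 * x\<^sup>2 + 2 * y\<^sup>2"
    using zero_le_power2[of "x - y"] by (simp add: power2_eq_square algebra_simps)
  also have "2 * x\<^sup>2 = U\<^sup>2 / (2 * n\<^sup>2)" by (simp add: x_def power_divide power_mult_distrib)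
  also have "2 * y\<^sup>2 = q\<^sup>2 * W\<^sup>2 / (8 * n\<^sup>2) * W\<^sup>2"
    by (simp add: y_def power2_eq_square)
  also have "\<dots> \<le> q\<^sup>2 * W\<^sup>2 / (8 * n\<^sup>2) * (4 * n\<^sup>2)"
    using W by (intro mult_left_mono) auto
  also have "\<dots> = q\<^sup>2 * W\<^sup>2 / 2" using n by simp
  finally show ?thesis by (simp add: x_def y_def)
qed

text \<open>Passes from the distance to its square, for which there is an explicit formula. With r =
  1 / sqrt 2 the difference of squares is (D - r)(D + r), and D + r is at least r because
  \<open>D\<close> is nonnegative.\<close>

lemma deviation_square_ge:
  fixes D \<epsilon> :: real
  assumes "D \<ge> 0" "\<epsilon> > 0" "\<bar>D - 1 / sqrt 2\<bar> \<ge> \<epsilon>"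
  shows "\<epsilon>\<^sup>2 / 2 \<le> (D\<^sup>2 - 1 / 2)\<^sup>2"
proof -
  define r where "r = 1 / sqrt 2"
  have r: "r > 0" "r\<^sup>2 = 1 / 2" by (simp_all add: r_def power_divide)
  have "\<epsilon>\<^sup>2 * r\<^sup>2 \<le> (D - r)\<^sup>2 * (D + r)\<^sup>2"
    using assms r by (intro mult_mono) (auto simp: r_def[symmetric] abs_le_square_iff[symmetric])
  also have "\<dots> = (D\<^sup>2 - r\<^sup>2)\<^sup>2" by (simp add: power2_eq_square algebra_simps)
  finally show ?thesis by (simp add: r)
qed

section \<open>Distances between random vertices\<close>

context
  fixes p :: nat and N :: int
  assumes p: "Factorial_Ring.prime p" and N: "N \<ge> 1"
begin

definition sign_point :: "(nat \<Rightarrow> int) \<Rightarrow> complex" where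
  "sign_point s = cyc_sum p (\<lambda>j. N * s j)"

lemma cyc_V_eq: "cyc_V p N = sign_point ` signs {1..p - 1}"
proof
  show "sign_point ` signs {1..p - 1} \<subseteq> cyc_V p N"
  proof (clarify)
    fix s assume s: "s \<in> signs {1..p - 1}"
    have "N * s j \<in> {-N, N}" if "j \<in> {1..p - 1}" for j
      using PiE_mem[OF s that] by auto
    thus "sign_point s \<in> cyc_V p N"
      unfolding cyc_V_def sign_point_def cyc_sum_def
      by (intro CollectI exI[of _ "\<lambda>j. N * s j"] conjI ballI refl)
  qed
  show "cyc_V p N \<subseteq> sign_point ` signs {1..p - 1}"
  proof
    fix x assume "x \<in> cyc_V p N"
    then obtain a where a: "x = cyc_sum p a" "\<forall>j\<in>{1..p - 1}. a j \<in> {-N, N}"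
      unfolding cyc_V_def cyc_sum_def by blast
    define s where "s = restrict (\<lambda>j. if a j = N then 1 else -1 :: int) {1..p - 1}"
    have "s \<in> signs {1..p - 1}" by (auto simp: s_def)
    moreover have "a j = N * s j" if "j \<in> {1..p - 1}" for j
      using bspec[OF a(2) that] that by (auto simp: s_def)
    hence "x = sign_point s"
      unfolding a(1) sign_point_def cyc_sum_def by (intro sum.cong) simp_all
    ultimately show "x \<in> sign_point ` signs {1..p - 1}" by blast
  qed
qed

text \<open>By linear independence of the powers of omega, counting vertices amounts to counting
  sign vectors.\<close>

lemma inj_on_sign_point: "inj_on sign_point (signs {1..p - 1})"
proof (rule inj_onI)
  fix s t assume st: "s \<in> signs {1..p - 1}" "t \<in> signs {1..p - 1}" "sign_point s = sign_point t"
  hence "cyc_sum p (\<lambda>j. N * s j - N * t j) = 0"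
    by (simp add: sign_point_def flip: cyc_sum_diff)
  hence "N * s j - N * t j = 0" if "j \<in> {1..p - 1}" for j
    using cyc_sum_eq_0[OF p _ that] by blast
  hence "s j = t j" if "j \<in> {1..p - 1}" for j
    using that N by fastforce
  thus "s = t" by (rule PiE_ext[OF st(1,2)])
qed

lemma card_cyc_V: "card (cyc_V p N) = 2 ^ (p - 1)"
  unfolding cyc_V_eq card_image[OF inj_on_sign_point] by (simp add: card_PiE numeral_2_eq_2)

text \<open>In the norm formula for the difference, signs square to 1, so (t_j - s_j)^2 = 2 - 2 s_j
  t_j. The constants 2 add up to the main term 1/2 after normalization, and \<open>N\<close>
  cancels.\<close>

lemma cyc_ndist_sign_point:
  assumes s: "s \<in> signs {1..p - 1}" and t: "t \<in> signs {1..p - 1}"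
  shows "(cyc_ndist p N (sign_point s) (sign_point t))\<^sup>2 - 1 / 2 =
    - ((\<Sum>j = 1..p - 1. real_of_int (s j) * t j) / (2 * real (p - 1)) +
       (real p + 1) / (real p)\<^sup>2 * ((\<Sum>j = 1..p - 1. real_of_int (t j)) - (\<Sum>j = 1..p - 1. real_of_int (s j)))\<^sup>2 / (4 * real (p - 1)))"
proof -
  define n where "n = real (p - 1)"
  define U where "U = (\<Sum>j = 1..p - 1. real_of_int (s j) * t j)"
  define W where "W = (\<Sum>j = 1..p - 1. real_of_int (t j)) - (\<Sum>j = 1..p - 1. real_of_int (s j))"
  have n: "n > 0" "real p - 1 = n" and p0: "real p > 0" and N0: "real_of_int N > 0"
    using p_gt_1[OF p] N by (auto simp: n_def of_nat_diff)
  have "sign_point t - sign_point s = cyc_sum p (\<lambda>j. N * (t j - s j))"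
    unfolding sign_point_def cyc_sum_diff by (simp add: algebra_simps)
  hence "(cyc_dist p (sign_point s) (sign_point t))\<^sup>2 =
     (real p)\<^sup>2 * (\<Sum>j = 1..p - 1. (N * (real_of_int (t j) - s j))\<^sup>2) -
     (real p + 1) * (\<Sum>j = 1..p - 1. N * (real_of_int (t j) - s j))\<^sup>2"
    by (simp add: cyc_dist_def cyc_norm_cyc_sum[OF p])
  also have "(\<Sum>j = 1..p - 1. N * (real_of_int (t j) - s j)) = N * W"
    by (simp add: W_def sum_subtractf flip: sum_distrib_left)
  also have "(\<Sum>j = 1..p - 1. (N * (real_of_int (t j) - s j))\<^sup>2) = (\<Sum>j = 1..p - 1. N\<^sup>2 * (2 - 2 * (real_of_int (s j) * t j)))"
  proof (rule sum.cong[OF refl])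
    fix j assume "j \<in> {1..p - 1}"
    hence "s j \<in> {-1, 1}" "t j \<in> {-1, 1}" using s t by (auto dest: PiE_mem)
    thus "(N * (real_of_int (t j) - s j))\<^sup>2 = N\<^sup>2 * (2 - 2 * (real_of_int (s j) * t j))"
      by (auto simp: power2_eq_square)
  qed
  also have "\<dots> = (real_of_int N)\<^sup>2 * (2 * n - 2 * U)"
    by (simp add: U_def n_def sum_subtractf flip: sum_distrib_left)
  finally have D: "(cyc_dist p (sign_point s) (sign_point t))\<^sup>2 =
     (real_of_int N)\<^sup>2 * ((real p)\<^sup>2 * (2 * n - 2 * U) - (real p + 1) * W\<^sup>2)"
    by (simp add: power_mult_distrib algebra_simps)
  have "(cyc_ndist p N (sign_point s) (sign_point t))\<^sup>2 =
     (real_of_int N)\<^sup>2 * ((real p)\<^sup>2 * (2 * n - 2 * U) - (real p + 1) * W\<^sup>2) / (4 * (real_of_int N)\<^sup>2 * (real p)\<^sup>2 * n)"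
    using n by (simp add: cyc_ndist_def power_divide power_mult_distrib D)
  also have "\<dots> = 1 / 2 - (U / (2 * n) + (real p + 1) / (real p)\<^sup>2 * W\<^sup>2 / (4 * n))"
    using n p0 N0 by (simp add: field_simps)
  finally show ?thesis by (simp add: U_def W_def n_def)
qed

text \<open>For fixed \<open>s\<close>, the sum \<open>U s t\<close> is a random sign sum in
  \<open>t\<close> with weights of modulus 1, so its mean square is \<open>n\<close>, as is that of
  \<open>T\<close>. Together with the pointwise bound this leaves 1 / (2 n) + 2 n q^2 for the
  mean.\<close>

lemma sum_deviation_square:
  "(\<Sum>s\<in>signs {1..p - 1}. \<Sum>t\<in>signs {1..p - 1}.
      ((cyc_ndist p N (sign_point s) (sign_point t))\<^sup>2 - 1 / 2)\<^sup>2) \<le> 5 / real p * (2 ^ (p - 1))\<^sup>2"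
proof -
  define J where "J = {1..p - 1}"
  define n where "n = real (p - 1)"
  define M :: real where "M = 2 ^ (p - 1)"
  define q where "q = (real p + 1) / (real p)\<^sup>2"
  define T where "T = (\<lambda>s :: nat \<Rightarrow> int. \<Sum>j\<in>J. real_of_int (s j))"
  define U where "U = (\<lambda>s t :: nat \<Rightarrow> int. \<Sum>j\<in>J. real_of_int (s j) * t j)"
  have p2: "p \<ge> 2" using p by (rule prime_ge_2_nat)
  have n: "n > 0" and pn: "real p = n + 1" "n \<ge> 1"
    using p2 by (auto simp: n_def of_nat_diff)
  have cardJ: "card J = p - 1" "finite J" by (simp_all add: J_def)
  have cardS: "real (card (signs J)) = M"
    using cardJ by (simp add: M_def card_PiE numeral_2_eq_2)
  have abs1: "\<bar>real_of_int (s j)\<bar> = 1" if "s \<in> signs J" "j \<in> J" for s j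
    using PiE_mem[OF that] by auto
  \<comment> \<open>This trivial bound supplies the hypothesis on \<open>W\<close> in
    \<open>le_second_moment_term\<close>.\<close>
  have absT: "\<bar>T s\<bar> \<le> n" if "s \<in> signs J" for s
  proof -
    have "\<bar>T s\<bar> \<le> (\<Sum>j\<in>J. \<bar>real_of_int (s j)\<bar>)" unfolding T_def by (rule sum_abs)
    also have "\<dots> = n" using that by (simp add: abs1 n_def cardJ)
    finally show ?thesis .
  qed
  have sumT: "(\<Sum>s\<in>signs J. (T s)\<^sup>2) = M * n"
    using sum_signs_square[of J "\<lambda>_. 1"] cardJ by (simp add: T_def M_def n_def)
  have sumU: "(\<Sum>t\<in>signs J. (U s t)\<^sup>2) = M * n" if s: "s \<in> signs J" for s
  proof -
    have "(\<Sum>j\<in>J. (real_of_int (s j))\<^sup>2) = (\<Sum>j\<in>J. 1)"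
      by (rule sum.cong[OF refl]) (metis abs1 s power2_abs one_power2)
    thus ?thesis using sum_signs_square[of J "\<lambda>j. real_of_int (s j)"] cardJ by (simp add: U_def M_def n_def)
  qed
  have bound: "((cyc_ndist p N (sign_point s) (sign_point t))\<^sup>2 - 1 / 2)\<^sup>2
      \<le> (U s t)\<^sup>2 / (2 * n\<^sup>2) + q\<^sup>2 * ((T s)\<^sup>2 + (T t)\<^sup>2)"
    if s: "s \<in> signs J" and t: "t \<in> signs J" for s t
  proof -
    have "((cyc_ndist p N (sign_point s) (sign_point t))\<^sup>2 - 1 / 2)\<^sup>2 =
        (U s t / (2 * n) + q * (T t - T s)\<^sup>2 / (4 * n))\<^sup>2"
      using cyc_ndist_sign_point[of s t] s t by (simp only: J_def U_def T_def n_def q_def power2_minus)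
    also have "\<dots> \<le> (U s t)\<^sup>2 / (2 * n\<^sup>2) + q\<^sup>2 * (T t - T s)\<^sup>2 / 2"
    proof (rule le_second_moment_term[OF n])
      have "\<bar>T t - T s\<bar> \<le> 2 * n" using absT[OF s] absT[OF t] by linarith
      hence "(T t - T s)\<^sup>2 \<le> (2 * n)\<^sup>2" by (rule abs_le_square_iff[THEN iffD1, OF order_trans]) (use n in simp)
      thus "(T t - T s)\<^sup>2 \<le> 4 * n\<^sup>2" by (simp add: power_mult_distrib)
    qed
    \<comment> \<open>Splitting the square separates \<open>s\<close> from \<open>t\<close>, so
      one-variable second moments suffice.\<close>
    also have "q\<^sup>2 * (T t - T s)\<^sup>2 / 2 \<le> q\<^sup>2 * ((T s)\<^sup>2 + (T t)\<^sup>2)"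
    proof -
      have "(T t - T s)\<^sup>2 \<le> 2 * ((T s)\<^sup>2 + (T t)\<^sup>2)"
        using zero_le_power2[of "T s + T t"] by (simp add: power2_eq_square algebra_simps)
      from mult_left_mono[OF this, of "q\<^sup>2"] show ?thesis by (simp add: algebra_simps)
    qed
    finally show ?thesis by simp
  qed
  have "(\<Sum>s\<in>signs J. \<Sum>t\<in>signs J. ((cyc_ndist p N (sign_point s) (sign_point t))\<^sup>2 - 1 / 2)\<^sup>2)
      \<le> (\<Sum>s\<in>signs J. \<Sum>t\<in>signs J. (U s t)\<^sup>2 / (2 * n\<^sup>2) + q\<^sup>2 * ((T s)\<^sup>2 + (T t)\<^sup>2))"
    by (intro sum_mono bound)
  also have "\<dots> = (\<Sum>s\<in>signs J. M * n / (2 * n\<^sup>2) + q\<^sup>2 * (M * (T s)\<^sup>2 + M * n))"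
    by (rule sum.cong[OF refl])
      (simp add: sum.distrib sumU sumT cardS flip: sum_divide_distrib sum_distrib_left)
  also have "\<dots> = M\<^sup>2 * (1 / (2 * n) + 2 * n * q\<^sup>2)"
  proof -
    have "(\<Sum>s\<in>signs J. M * n / (2 * n\<^sup>2) + q\<^sup>2 * (M * (T s)\<^sup>2 + M * n)) =
        M * (M * n / (2 * n\<^sup>2)) + q\<^sup>2 * (M * (M * n) + M * (M * n))"
      by (simp only: sum.distrib sum_distrib_left[symmetric] sum_constant cardS sumT)
    thus ?thesis using n by (simp add: power2_eq_square field_simps)
  qed
  also have "\<dots> \<le> M\<^sup>2 * (5 / real p)"
  proof (rule mult_left_mono)
    \<comment> \<open>From \<open>n \<ge> 1\<close> one has p = n + 1 \<le> 2 n.\<close>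
    have "1 / (2 * n) \<le> 1 / real p" using pn by (simp add: field_simps)
    moreover have "2 * n * q\<^sup>2 \<le> 4 / real p"
    proof -
      have "n * (real p + 1)\<^sup>2 \<le> 2 * real p ^ 3"
      proof -
        \<comment> \<open>This cubic is exactly 2 (n + 1)^3 - n (n + 2)^2.\<close>
        have "0 \<le> n ^ 3 + 2 * n\<^sup>2 + 2 * n + 2" using n by (intro add_nonneg_nonneg) auto
        thus ?thesis unfolding pn(1) by (simp add: power2_eq_square power3_eq_cube algebra_simps)
      qed
      hence "2 * n * q\<^sup>2 \<le> 2 * (2 * real p ^ 3) / real p ^ 4"
        by (simp add: q_def power_divide divide_right_mono flip: power_mult)
      also have "\<dots> = 4 / real p" using p2 by (simp add: field_simps eval_nat_numeral)
      finally show ?thesis .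
    qed
    ultimately show "1 / (2 * n) + 2 * n * q\<^sup>2 \<le> 5 / real p" by (simp add: add_divide_distrib)
  qed simp
  finally show ?thesis by (simp add: J_def M_def mult.commute)
qed

text \<open>Chebyshev's inequality: each deviating pair contributes at least \<epsilon>^2 / 2 to the
  sum of squared deviations, which turns the constant 5 into 10.\<close>

lemma card_deviation:
  assumes \<epsilon>: "\<epsilon> > 0"
  shows "real (card {(\<beta>1, \<beta>2) \<in> cyc_V p N \<times> cyc_V p N. \<bar>cyc_ndist p N \<beta>1 \<beta>2 - 1 / sqrt 2\<bar> \<ge> \<epsilon>})
    \<le> 10 / (\<epsilon>\<^sup>2 * real p) * (2 ^ (p - 1))\<^sup>2"
proof -
  define S where "S = signs {1..p - 1}"
  define D where "D = (\<lambda>(s, t). cyc_ndist p N (sign_point s) (sign_point t))"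
  define B where "B = {x \<in> S \<times> S. \<bar>D x - 1 / sqrt 2\<bar> \<ge> \<epsilon>}"
  have fin: "finite S" "finite B"
    by (auto simp: S_def B_def intro!: finite_PiE intro: finite_subset[OF Collect_subset])
  have D0: "D x \<ge> 0" for x
    using N p by (auto simp: D_def cyc_ndist_def cyc_dist_def cyc_norm_def split: prod.splits
        intro!: divide_nonneg_nonneg mult_nonneg_nonneg dest: prime_gt_0_nat)
  have "{(\<beta>1, \<beta>2) \<in> cyc_V p N \<times> cyc_V p N. \<bar>cyc_ndist p N \<beta>1 \<beta>2 - 1 / sqrt 2\<bar> \<ge> \<epsilon>}
      \<subseteq> (\<lambda>(s, t). (sign_point s, sign_point t)) ` B"
    unfolding cyc_V_eq S_def[symmetric] by (force simp: B_def D_def)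
  hence "card {(\<beta>1, \<beta>2) \<in> cyc_V p N \<times> cyc_V p N. \<bar>cyc_ndist p N \<beta>1 \<beta>2 - 1 / sqrt 2\<bar> \<ge> \<epsilon>} \<le> card B"
    using fin by (meson surj_card_le)
  moreover have "real (card B) \<le> 10 / (\<epsilon>\<^sup>2 * real p) * (2 ^ (p - 1))\<^sup>2"
  proof -
    have "real (card B) * (\<epsilon>\<^sup>2 / 2) = (\<Sum>x\<in>B. \<epsilon>\<^sup>2 / 2)" by simp
    also have "\<dots> \<le> (\<Sum>x\<in>B. ((D x)\<^sup>2 - 1 / 2)\<^sup>2)"
      using \<epsilon> D0 by (intro sum_mono deviation_square_ge) (auto simp: B_def)
    also have "\<dots> \<le> (\<Sum>x\<in>S \<times> S. ((D x)\<^sup>2 - 1 / 2)\<^sup>2)"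
      using fin by (intro sum_mono2) (auto simp: B_def)
    also have "\<dots> = (\<Sum>s\<in>S. \<Sum>t\<in>S. ((D (s, t))\<^sup>2 - 1 / 2)\<^sup>2)"
      by (simp add: sum.cartesian_product)
    also have "\<dots> \<le> 5 / real p * (2 ^ (p - 1))\<^sup>2"
      using sum_deviation_square by (simp add: D_def S_def)
    finally show ?thesis using \<epsilon> p_gt_1[OF p] by (simp add: field_simps)
  qed
  ultimately show ?thesis by (meson of_nat_mono order_trans)
qed

end

theorem theorem3:
  shows "\<exists>C1 C2 :: real. C1 > 0 \<and> C2 > 0 \<and>
    (\<forall>(\<epsilon>::real) (N::int) (p::nat).
       0 < \<epsilon> \<and> \<epsilon> < 1 \<and> N \<ge> 1 \<and> Factorial_Ring.prime p \<and> odd p \<and> real p > C1 / \<epsilon> \<longrightarrow>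
       1 / (real (card (cyc_V p N)))\<^sup>2 *
         real (card {(\<beta>1, \<beta>2) \<in> cyc_V p N \<times> cyc_V p N.
                       \<bar>cyc_ndist p N \<beta>1 \<beta>2 - 1 / sqrt 2\<bar> \<ge> \<epsilon>})
       \<le> C2 / (\<epsilon>\<^sup>2 * real p))"
\<comment> \<open>The witness 10 for \<open>C2\<close> is the constant of
  \<open>card_deviation\<close>; the factor \<open>(2 ^ (p - 1))\<^sup>2\<close> there is the number
  of all pairs of vertices.\<close>
proof (rule exI[of _ 1], rule exI[of _ 10], intro conjI allI impI)
  fix \<epsilon> :: real and N :: int and p :: nat
  assume *: "0 < \<epsilon> \<and> \<epsilon> < 1 \<and> N \<ge> 1 \<and> Factorial_Ring.prime p \<and> odd p \<and> real p > 1 / \<epsilon>"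
  let ?B = "{(\<beta>1, \<beta>2) \<in> cyc_V p N \<times> cyc_V p N. \<bar>cyc_ndist p N \<beta>1 \<beta>2 - 1 / sqrt 2\<bar> \<ge> \<epsilon>}"
  have "real (card ?B) \<le> 10 / (\<epsilon>\<^sup>2 * real p) * (2 ^ (p - 1))\<^sup>2"
    using * by (intro card_deviation) auto
  hence "real (card ?B) / (2 ^ (p - 1))\<^sup>2 \<le> 10 / (\<epsilon>\<^sup>2 * real p)"
    by (subst pos_divide_le_eq) auto
  thus "1 / (real (card (cyc_V p N)))\<^sup>2 * real (card ?B) \<le> 10 / (\<epsilon>\<^sup>2 * real p)"
    using * by (simp add: card_cyc_V)
qed simp_all

end
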